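(* Let $G_1$ and $G_2$ be abelian groups, and let $S_1 \subseteq G_1$ and $S_2 \subseteq G_2$ be symmetric subsets such that $\operatorname{Cay}(G_1; S_1)$ and $\operatorname{Cay}(G_2; S_2)$ are connected. Assume that $\operatorname{Cay}(G_1; S_1)$ is chromatically isomorphic to $\operatorname{Cay}(G_2; S_2)$ (i.e., there exists a chromatic isomorphism from the first to the second). Then the following are equivalent: (1) Every chromatic isomorphism from $\operatorname{Cay}(G_1; S_1)$ to $\operatorname{Cay}(G_2; S_2)$ is affine. (2) $|G_1: \langle T(S_1,2s)\rangle|\leq 2$ for all $s\in S_1$ with $|s|=4$. (3) $|G_2: \langle T(S_2,2t)\rangle|\leq 2$ for all $t\in S_2$ with $|t|=4$.
   Context: Groups are abelian, written additively, and may be infinite; $|s|$ denotes the order of the element $s$, and $\langle X \rangle$ the subgroup generated by $X$. A subset $S$ of an abelian group $G$ is symmetric if $S = -S$. For symmetric $S \subseteq G$, the abelian Cayley graph $\operatorname{Cay}(G;S)$ is the undirected graph whose vertices are the elements of $G$, with an edge joining $g$ and $g+s$ for all $g \in G$ and $s \in S$. (It is connected if and only if $S$ generates $G$.) The edge joining $g$ and $g+s$ is coloured with the set $\{\pm s\}$. For a subset $S$ of an abelian group $G$ and $c \in G$, put $T(S,c) := \{\, t \in S \mid 2t \neq c \,\} \cup \{c\}$. A graph isomorphism $\varphi$ from an abelian Cayley graph $\operatorname{Cay}(G_1;S_1)$ to an abelian Cayley graph $\operatorname{Cay}(G_2;S_2)$ is chromatic if there is a bijection $\pi \colon S_1 \to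 S_2$ such that $\varphi(g+s) \in \{\varphi(g) \pm \pi(s)\}$ for all $g \in G_1$ and $s \in S_1$. A bijection $\varphi \colon G_1 \to G_2$ between abelian groups is affine if there are a group isomorphism $\tau \colon G_1 \to G_2$ and an element $g_2 \in G_2$ such that $\varphi(x) = \tau(x) + g_2$ for all $x \in G_1$.
   Formalization: The bijection π of a chromatic isomorphism is also required to satisfy π(-s) = -π(s) for all s in S_1; without this the claim is false, e.g. for the 4-cycles Cay(Z_2×Z_2; {a,b}) and Cay(Z_4; {1,-1}). *)

theory Defs
  imports "HOL-Algebra.Algebra"
begin

text \<open>
  Abelian groups are written multiplicatively, as \<open>comm_group\<close>: the sum of two elements
  is their product, \<open>-s\<close> is \<open>inv s\<close>, and \<open>2t\<close> is \<open>t [^] 2\<close>.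
  Functions between groups matter only on the carriers.
\<close>

text \<open>
  An undirected graph is a vertex set together with a set of edges \<open>{u, v}\<close>; a singleton
  edge \<open>{u}\<close> is a loop.
\<close>

type_synonym 'a ugraph = "'a set \<times> 'a set set"

definition connected_graph :: "'a ugraph \<Rightarrow> bool" where
  "connected_graph \<Gamma> \<longleftrightarrow>
     (\<forall>u \<in> fst \<Gamma>. \<forall>v \<in> fst \<Gamma>. (\<lambda>x y. {x, y} \<in> snd \<Gamma>)\<^sup>*\<^sup>* u v)"

definition graph_iso :: "'a ugraph \<Rightarrow> 'b ugraph \<Rightarrow> ('a \<Rightarrow> 'b) \<Rightarrow> bool" where
  "graph_iso \<Gamma> \<Delta> \<phi> \<longleftrightarrow>
     bij_betw \<phi> (fst \<Gamma>) (fst \<Delta>) \<and>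
     (\<forall>u \<in> fst \<Gamma>. \<forall>v \<in> fst \<Gamma>. {u, v} \<in> snd \<Gamma> \<longleftrightarrow> {\<phi> u, \<phi> v} \<in> snd \<Delta>)"

definition symmetric_subset :: "('a, 'm) monoid_scheme \<Rightarrow> 'a set \<Rightarrow> bool" where
  "symmetric_subset G S \<longleftrightarrow> S \<subseteq> carrier G \<and> m_inv G ` S = S"

definition Cay :: "('a, 'm) monoid_scheme \<Rightarrow> 'a set \<Rightarrow> 'a ugraph" where
  "Cay G S = (carrier G, {{g, g \<otimes>\<^bsub>G\<^esub> s} | g s. g \<in> carrier G \<and> s \<in> S})"

definition T_set :: "('a, 'm) monoid_scheme \<Rightarrow> 'a set \<Rightarrow> 'a \<Rightarrow> 'a set" where
  "T_set G S c = {t \<in> S. t [^]\<^bsub>G\<^esub> (2::nat) \<noteq> c} \<union> {c}"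

text \<open>
  The edge joining \<open>g\<close> and \<open>g + s\<close> has the colour \<open>{s, -s}\<close>, and \<open>\<pi>\<close> has to permute
  colours: \<open>{s, -s}\<close> goes to \<open>{\<pi> s, -\<pi> s}\<close>, different colours going to different colours.
  For a bijection \<open>\<pi>\<close> this means \<open>\<pi> (-s) = -\<pi> s\<close>. The condition on \<open>\<phi> (g + s)\<close> does not
  imply it: from the 4-cycle \<open>Cay (\<int>\<^sub>2 \<times> \<int>\<^sub>2; {a, b})\<close> with \<open>a\<close>, \<open>b\<close> of order 2 to the 4-cycle
  \<open>Cay (\<int>\<^sub>4; {1, -1})\<close>, which has just one colour, the map \<open>0, a, b, a + b \<mapsto> 0, 1, -1, 2\<close>
  satisfies that condition with \<open>\<pi> a = 1\<close>, \<open>\<pi> b = -1\<close>.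
\<close>

definition chromatic_iso ::
  "('a, 'm) monoid_scheme \<Rightarrow> 'a set \<Rightarrow> ('b, 'n) monoid_scheme \<Rightarrow> 'b set \<Rightarrow> ('a \<Rightarrow> 'b) \<Rightarrow> bool" where
  "chromatic_iso G S H R \<phi> \<longleftrightarrow>
     graph_iso (Cay G S) (Cay H R) \<phi> \<and>
     (\<exists>\<pi>. bij_betw \<pi> S R \<and>
        (\<forall>s \<in> S. \<pi> (inv\<^bsub>G\<^esub> s) = inv\<^bsub>H\<^esub> (\<pi> s)) \<and>
        (\<forall>g \<in> carrier G. \<forall>s \<in> S.
           \<phi> (g \<otimes>\<^bsub>G\<^esub> s) \<in> {\<phi> g \<otimes>\<^bsub>H\<^esub> \<pi> s, \<phi> g \<otimes>\<^bsub>H\<^esub> inv\<^bsub>H\<^esub> (\<pi> s)}))"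

definition affine_map ::
  "('a, 'm) monoid_scheme \<Rightarrow> ('b, 'n) monoid_scheme \<Rightarrow> ('a \<Rightarrow> 'b) \<Rightarrow> bool" where
  "affine_map G H \<phi> \<longleftrightarrow>
     bij_betw \<phi> (carrier G) (carrier H) \<and>
     (\<exists>\<tau> \<in> iso G H. \<exists>h \<in> carrier H. \<forall>x \<in> carrier G. \<phi> x = \<tau> x \<otimes>\<^bsub>H\<^esub> h)"

text \<open>Finiteness is explicit because \<open>card\<close> is 0 on infinite sets.\<close>

definition index_le :: "('a, 'm) monoid_scheme \<Rightarrow> 'a set \<Rightarrow> nat \<Rightarrow> bool" where
  "index_le G H n \<longleftrightarrow> finite (rcosets\<^bsub>G\<^esub> H) \<and> card (rcosets\<^bsub>G\<^esub> H) \<le> n"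

end

theory Submission
  imports Defs
begin

text \<open>
  Call \<open>x\<close> and \<open>y\<close> parallel if \<open>\<phi> (g + x + y) + \<phi> g = \<phi> (g + x) + \<phi> (g + y)\<close> for all \<open>g\<close>; the
  elements parallel to a given one form a subgroup, and \<open>\<phi>\<close> is affine iff everything is parallel.
  If \<open>s, t \<in> S\<^sub>1\<close> are not parallel for a chromatic \<open>\<phi>\<close>, comparing the two ways round the squares
  at \<open>g\<close> spanned by \<open>\<plusminus>s\<close> and \<open>t\<close>, for \<open>\<phi>\<close> and for its inverse, forces \<open>|s| = |t| = 4\<close> and
  \<open>2s = 2t\<close>. Hence \<open>H = \<langle>T (S\<^sub>1, 2s)\<rangle>\<close> is parallel to both \<open>s\<close> and \<open>t\<close>, so \<open>s \<notin> H\<close>; if \<open>H\<close> has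
  index at most 2, then \<open>t\<close> lies in \<open>H \<union> (s + H)\<close>, all of which is parallel to \<open>s\<close>, a
  contradiction. Conversely, if the index exceeds 2, adding \<open>2s\<close> on \<open>H\<close> and nothing elsewhere is a
  chromatic automorphism that is not affine. Inverting chromatic isomorphisms exchanges \<open>G\<^sub>1\<close>
  and \<open>G\<^sub>2\<close>.
\<close>

section \<open>Parallel elements of a map between abelian groups\<close>

definition parallel :: "('a, 'm) monoid_scheme \<Rightarrow> ('b, 'n) monoid_scheme \<Rightarrow> ('a \<Rightarrow> 'b) \<Rightarrow> 'a \<Rightarrow> 'a set"
  where "parallel G H \<phi> x = {y \<in> carrier G. \<forall>g \<in> carrier G.
    \<phi> (g \<otimes>\<^bsub>G\<^esub> x \<otimes>\<^bsub>G\<^esub> y) \<otimes>\<^bsub>H\<^esub> \<phi> g = \<phi> (g \<otimes>\<^bsub>G\<^esub> x) \<otimes>\<^bsub>H\<^esub> \<phi> (g \<otimes>\<^bsub>G\<^esub> y)}"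

lemma parallel_sym:
  assumes "comm_group G" "comm_group H" "\<phi> \<in> carrier G \<rightarrow> carrier H"
    and "x \<in> carrier G" "y \<in> parallel G H \<phi> x"
  shows "x \<in> parallel G H \<phi> y"
proof -
  interpret G: comm_group G by fact
  interpret H: comm_group H by fact
  have y: "y \<in> carrier G" using assms(5) by (simp add: parallel_def)
  have \<phi>: "\<phi> z \<in> carrier H" if "z \<in> carrier G" for z using assms(3) that by auto
  show ?thesis
    using assms(4,5) y by (simp add: parallel_def \<phi> G.m_ac H.m_comm)
qed

text \<open>Rearranged, \<open>y\<close> is parallel to \<open>x\<close> iff the function sending
  \<open>g\<close> to \<open>\<phi> (g + x) - \<phi> g\<close> has period \<open>y\<close>. The
  periods of a function form a subgroup.\<close>

lemma subgroup_parallel: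
  assumes "comm_group G" "comm_group H" "\<phi> \<in> carrier G \<rightarrow> carrier H" and x: "x \<in> carrier G"
  shows "subgroup (parallel G H \<phi> x) G"
proof -
  interpret G: comm_group G by fact
  interpret H: comm_group H by fact
  have \<phi>: "\<phi> z \<in> carrier H" if "z \<in> carrier G" for z using assms(3) that by auto
  show ?thesis
  proof (rule G.subgroupI)
    show "parallel G H \<phi> x \<subseteq> carrier G" by (auto simp: parallel_def)
    have "\<one>\<^bsub>G\<^esub> \<in> parallel G H \<phi> x" using x by (simp add: parallel_def \<phi>)
    then show "parallel G H \<phi> x \<noteq> {}" by auto
  next
    fix y assume y: "y \<in> parallel G H \<phi> x"
    then have yc: "y \<in> carrier G" by (simp add: parallel_def)
    have "\<phi> (g \<otimes>\<^bsub>G\<^esub> x \<otimes>\<^bsub>G\<^esub> inv\<^bsub>G\<^esub> y) \<otimes>\<^bsub>H\<^esub> \<phi> g = \<phi> (g \<otimes>\<^bsub>G\<^esub> x) \<otimes>\<^bsub>H\<^esub> \<phi> (g \<otimes>\<^bsub>G\<^esub> inv\<^bsub>G\<^esub> y)"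
      if g: "g \<in> carrier G" for g
    proof -
      \<comment> \<open>To see that \<open>-y\<close> is a period too, the equation for
        \<open>y\<close> is read at the point \<open>g - y\<close>.\<close>
      let ?k = "g \<otimes>\<^bsub>G\<^esub> inv\<^bsub>G\<^esub> y"
      have "\<phi> (?k \<otimes>\<^bsub>G\<^esub> x \<otimes>\<^bsub>G\<^esub> y) \<otimes>\<^bsub>H\<^esub> \<phi> ?k = \<phi> (?k \<otimes>\<^bsub>G\<^esub> x) \<otimes>\<^bsub>H\<^esub> \<phi> (?k \<otimes>\<^bsub>G\<^esub> y)"
        using y yc g by (simp add: parallel_def)
      moreover have kx: "?k \<otimes>\<^bsub>G\<^esub> x = g \<otimes>\<^bsub>G\<^esub> x \<otimes>\<^bsub>G\<^esub> inv\<^bsub>G\<^esub> y"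
        using g x yc by (simp add: G.m_ac)
      moreover have "?k \<otimes>\<^bsub>G\<^esub> x \<otimes>\<^bsub>G\<^esub> y = g \<otimes>\<^bsub>G\<^esub> x" "?k \<otimes>\<^bsub>G\<^esub> y = g"
        unfolding kx using g x yc by (simp_all add: G.m_assoc)
      ultimately show ?thesis by simp
    qed
    then show "inv\<^bsub>G\<^esub> y \<in> parallel G H \<phi> x" using yc by (simp add: parallel_def)
  next
    fix y z assume y: "y \<in> parallel G H \<phi> x" and z: "z \<in> parallel G H \<phi> x"
    then have yc: "y \<in> carrier G" and zc: "z \<in> carrier G" by (simp_all add: parallel_def)
    have "\<phi> (g \<otimes>\<^bsub>G\<^esub> x \<otimes>\<^bsub>G\<^esub> (y \<otimes>\<^bsub>G\<^esub> z)) \<otimes>\<^bsub>H\<^esub> \<phi> g = \<phi> (g \<otimes>\<^bsub>G\<^esub> x) \<otimes>\<^bsub>H\<^esub> \<phi> (g \<otimes>\<^bsub>G\<^esub> (y \<otimes>\<^bsub>G\<^esub> z))"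
      if g: "g \<in> carrier G" for g
    proof -
      define A B C D E F where "A = \<phi> (g \<otimes>\<^bsub>G\<^esub> x \<otimes>\<^bsub>G\<^esub> (y \<otimes>\<^bsub>G\<^esub> z))" and "B = \<phi> g"
        and "C = \<phi> (g \<otimes>\<^bsub>G\<^esub> x)" and "D = \<phi> (g \<otimes>\<^bsub>G\<^esub> (y \<otimes>\<^bsub>G\<^esub> z))" and "E = \<phi> (g \<otimes>\<^bsub>G\<^esub> y)"
        and "F = \<phi> (g \<otimes>\<^bsub>G\<^esub> x \<otimes>\<^bsub>G\<^esub> y)"
      note defs = this
      have c: "A \<in> carrier H" "B \<in> carrier H" "C \<in> carrier H" "D \<in> carrier H" "E \<in> carrier H"
        "F \<in> carrier H"
        unfolding defs using g x yc zc by (auto intro!: \<phi>)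
      have 1: "F \<otimes>\<^bsub>H\<^esub> B = C \<otimes>\<^bsub>H\<^esub> E"
        unfolding defs using y g by (simp add: parallel_def)
      \<comment> \<open>The equation for \<open>z\<close> is taken at the point
        \<open>g + y\<close>. Combined with \<open>1\<close> it gives the claim once
        \<open>E\<close>, the value at \<open>g + y\<close>, is cancelled.\<close>
      have "\<phi> (g \<otimes>\<^bsub>G\<^esub> y \<otimes>\<^bsub>G\<^esub> x \<otimes>\<^bsub>G\<^esub> z) \<otimes>\<^bsub>H\<^esub> \<phi> (g \<otimes>\<^bsub>G\<^esub> y) =
          \<phi> (g \<otimes>\<^bsub>G\<^esub> y \<otimes>\<^bsub>G\<^esub> x) \<otimes>\<^bsub>H\<^esub> \<phi> (g \<otimes>\<^bsub>G\<^esub> y \<otimes>\<^bsub>G\<^esub> z)"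
        using z g yc by (simp add: parallel_def)
      then have 2: "A \<otimes>\<^bsub>H\<^esub> E = F \<otimes>\<^bsub>H\<^esub> D"
        unfolding defs using g x yc zc by (simp add: G.m_ac)
      have "(A \<otimes>\<^bsub>H\<^esub> B) \<otimes>\<^bsub>H\<^esub> E = (A \<otimes>\<^bsub>H\<^esub> E) \<otimes>\<^bsub>H\<^esub> B" using c by (simp add: H.m_ac)
      also have "\<dots> = (F \<otimes>\<^bsub>H\<^esub> B) \<otimes>\<^bsub>H\<^esub> D" unfolding 2 using c by (simp add: H.m_ac)
      also have "\<dots> = (C \<otimes>\<^bsub>H\<^esub> D) \<otimes>\<^bsub>H\<^esub> E" unfolding 1 using c by (simp add: H.m_ac)
      finally show ?thesis using c unfolding defs by simp
    qed
    then show "y \<otimes>\<^bsub>G\<^esub> z \<in> parallel G H \<phi> x" using yc zc by (simp add: parallel_def)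
  qed
qed

section \<open>Cayley graphs of symmetric subsets\<close>

lemma symmetric_subsetD:
  assumes "symmetric_subset G S" "s \<in> S"
  shows "s \<in> carrier G" "inv\<^bsub>G\<^esub> s \<in> S"
  using assms by (auto simp: symmetric_subset_def)

text \<open>An edge is an unordered pair, so its base point may be \<open>u\<close> or
  \<open>v\<close>. If it is \<open>v\<close>, then \<open>v = u - s\<close>, and the symmetry of
  \<open>S\<close> supplies the generator \<open>-s\<close>.\<close>

lemma Cay_edge_iff:
  assumes "comm_group G" "symmetric_subset G S" "u \<in> carrier G" "v \<in> carrier G"
  shows "{u, v} \<in> snd (Cay G S) \<longleftrightarrow> (\<exists>s \<in> S. v = u \<otimes>\<^bsub>G\<^esub> s)"
proof
  interpret G: comm_group G by fact
  assume "{u, v} \<in> snd (Cay G S)"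
  then obtain g s where gs: "{u, v} = {g, g \<otimes>\<^bsub>G\<^esub> s}" "g \<in> carrier G" "s \<in> S"
    by (auto simp: Cay_def)
  then consider "v = u \<otimes>\<^bsub>G\<^esub> s" | "u = v \<otimes>\<^bsub>G\<^esub> s" by (auto simp: doubleton_eq_iff)
  then show "\<exists>s \<in> S. v = u \<otimes>\<^bsub>G\<^esub> s"
  proof cases
    case 2
    have "v = u \<otimes>\<^bsub>G\<^esub> inv\<^bsub>G\<^esub> s"
      unfolding 2 using symmetric_subsetD(1)[OF assms(2) gs(3)] assms(4) by (simp add: G.m_assoc)
    then show ?thesis using symmetric_subsetD(2)[OF assms(2) gs(3)] by blast
  qed (use gs in blast)
qed (use assms in \<open>auto simp: Cay_def\<close>)

text \<open>Each edge of a path from the identity adds one generator, so induction along the path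
  keeps its end in the generated subgroup.\<close>

lemma generate_of_connected_Cay:
  assumes "comm_group G" "symmetric_subset G S" "connected_graph (Cay G S)"
  shows "generate G S = carrier G"
proof
  interpret G: comm_group G by fact
  have S: "S \<subseteq> carrier G" using assms(2) by (simp add: symmetric_subset_def)
  then show "generate G S \<subseteq> carrier G" by (rule G.generate_incl)
  show "carrier G \<subseteq> generate G S"
  proof
    fix v assume "v \<in> carrier G"
    then have "(\<lambda>x y. {x, y} \<in> snd (Cay G S))\<^sup>*\<^sup>* \<one>\<^bsub>G\<^esub> v"
      using assms(3) by (simp add: connected_graph_def Cay_def)
    then show "v \<in> generate G S"
    proof induction
      case base
      show ?case by (rule generate.one)
    next
      case (step y z)
      have yz: "y \<in> carrier G" "z \<in> carrier G"
        using step(2) S by (auto simp: Cay_def doubleton_eq_iff)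
      then obtain s where "s \<in> S" "z = y \<otimes>\<^bsub>G\<^esub> s"
        using step(2) Cay_edge_iff[OF assms(1,2)] by blast
      then show ?case using step.IH by (auto intro: generate.eng generate.incl)
    qed
  qed
qed

section \<open>Chromatic isomorphisms through their colour permutations\<close>

definition colour_perm ::
  "('a, 'm) monoid_scheme \<Rightarrow> 'a set \<Rightarrow> ('b, 'n) monoid_scheme \<Rightarrow> 'b set \<Rightarrow> ('a \<Rightarrow> 'b) \<Rightarrow> ('a \<Rightarrow> 'b) \<Rightarrow> bool"
  where "colour_perm G S H R \<phi> \<pi> \<longleftrightarrow> bij_betw \<pi> S R \<and>
    (\<forall>s \<in> S. \<pi> (inv\<^bsub>G\<^esub> s) = inv\<^bsub>H\<^esub> (\<pi> s)) \<and>
    (\<forall>g \<in> carrier G. \<forall>s \<in> S. \<phi> (g \<otimes>\<^bsub>G\<^esub> s) \<in> {\<phi> g \<otimes>\<^bsub>H\<^esub> \<pi> s, \<phi> g \<otimes>\<^bsub>H\<^esub> inv\<^bsub>H\<^esub> (\<pi> s)})"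

text \<open>The two Cayley graphs enter symmetrically: \<open>flip\<close> lets a result about
  \<open>\<phi>\<close> be reused for its inverse, and \<open>cayley_pair_self\<close> specialises
  it to automorphisms of the first graph.\<close>

locale cayley_pair = G: comm_group G + H: comm_group H
  for G :: "('a, 'm) monoid_scheme" (structure) and H :: "('b, 'n) monoid_scheme" (structure) +
  fixes S :: "'a set" and R :: "'b set"
  assumes sym_S: "symmetric_subset G S" and sym_R: "symmetric_subset H R"
begin

lemmas S_closed = symmetric_subsetD[OF sym_S]
lemmas R_closed = symmetric_subsetD[OF sym_R]

lemma flip: "cayley_pair H G R S"
  by (simp add: cayley_pair_def cayley_pair_axioms_def sym_S sym_R G.comm_group_axioms H.comm_group_axioms)

lemma cayley_pair_self: "cayley_pair G G S S"
  by (simp add: cayley_pair_def cayley_pair_axioms_def sym_S G.comm_group_axioms)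

text \<open>Otherwise \<open>g + s\<close> and \<open>g - s\<close> would both be sent to
  \<open>\<phi> g - \<pi> s\<close>. Injectivity then gives \<open>-s = s\<close>, hence
  \<open>\<pi> s = -\<pi> s\<close>, because \<open>\<pi>\<close> respects inverses, and the value
  \<open>\<phi> g + \<pi> s\<close> is attained after all.\<close>

lemma colour_perm_surj:
  assumes "bij_betw \<phi> (carrier G) (carrier H)" "colour_perm G S H R \<phi> \<pi>"
    and g: "g \<in> carrier G" and s: "s \<in> S"
  obtains u where "u \<in> {s, inv\<^bsub>G\<^esub> s}" "\<phi> (g \<otimes>\<^bsub>G\<^esub> u) = \<phi> g \<otimes>\<^bsub>H\<^esub> \<pi> s"
proof -
  have \<phi>: "\<phi> z \<in> carrier H" if "z \<in> carrier G" for z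
    using assms(1) that by (auto simp: bij_betw_def)
  have sc: "s \<in> carrier G" "inv\<^bsub>G\<^esub> s \<in> S" using S_closed s by auto
  have pc: "\<pi> s \<in> carrier H" using assms(2) s R_closed(1) by (auto simp: colour_perm_def bij_betw_def)
  have pi: "\<pi> (inv\<^bsub>G\<^esub> s) = inv\<^bsub>H\<^esub> (\<pi> s)" using assms(2) s by (simp add: colour_perm_def)
  have step: "\<phi> (g \<otimes>\<^bsub>G\<^esub> t) \<in> {\<phi> g \<otimes>\<^bsub>H\<^esub> \<pi> t, \<phi> g \<otimes>\<^bsub>H\<^esub> inv\<^bsub>H\<^esub> (\<pi> t)}" if "t \<in> S" for t
    using assms(2) g that by (simp add: colour_perm_def)
  have "\<exists>u \<in> {s, inv\<^bsub>G\<^esub> s}. \<phi> (g \<otimes>\<^bsub>G\<^esub> u) = \<phi> g \<otimes>\<^bsub>H\<^esub> \<pi> s"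
  proof (rule ccontr)
    assume no: "\<not> ?thesis"
    then have "\<phi> (g \<otimes>\<^bsub>G\<^esub> s) = \<phi> g \<otimes>\<^bsub>H\<^esub> inv\<^bsub>H\<^esub> (\<pi> s)" using step[OF s] by auto
    moreover have "\<phi> (g \<otimes>\<^bsub>G\<^esub> inv\<^bsub>G\<^esub> s) = \<phi> g \<otimes>\<^bsub>H\<^esub> inv\<^bsub>H\<^esub> (\<pi> s)"
      using no step[OF sc(2)] pc unfolding pi by auto
    ultimately have "g \<otimes>\<^bsub>G\<^esub> s = g \<otimes>\<^bsub>G\<^esub> inv\<^bsub>G\<^esub> s"
      using inj_onD[OF bij_betw_imp_inj_on[OF assms(1)]] g s S_closed by auto
    then have "inv\<^bsub>G\<^esub> s = s" using g sc by simp
    then have "\<pi> s = inv\<^bsub>H\<^esub> (\<pi> s)" using pi by simp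
    then show False using no step[OF s] by auto
  qed
  then show thesis using that by blast
qed

text \<open>For a bijection the colour condition already makes the graph isomorphism automatic.
  Edges go to edges since \<open>R\<close> is symmetric; conversely, by
  \<open>colour_perm_surj\<close> every neighbour of \<open>\<phi> u\<close> is the image of a
  neighbour of \<open>u\<close>.\<close>

lemma chromatic_iso_iff:
  "chromatic_iso G S H R \<phi> \<longleftrightarrow>
    bij_betw \<phi> (carrier G) (carrier H) \<and> (\<exists>\<pi>. colour_perm G S H R \<phi> \<pi>)"
    (is "_ \<longleftrightarrow> ?rhs")
proof
  assume "chromatic_iso G S H R \<phi>"
  then show ?rhs unfolding chromatic_iso_def graph_iso_def colour_perm_def by (simp add: Cay_def)
next
  assume rhs: ?rhs
  then obtain \<pi> where bij: "bij_betw \<phi> (carrier G) (carrier H)" and \<pi>: "colour_perm G S H R \<phi> \<pi>"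
    by blast
  have \<phi>: "\<phi> z \<in> carrier H" if "z \<in> carrier G" for z
    using bij that by (auto simp: bij_betw_def)
  have "{u, v} \<in> snd (Cay G S) \<longleftrightarrow> {\<phi> u, \<phi> v} \<in> snd (Cay H R)"
    if uv: "u \<in> carrier G" "v \<in> carrier G" for u v
  proof -
    have "(\<exists>s \<in> S. v = u \<otimes>\<^bsub>G\<^esub> s) \<longleftrightarrow> (\<exists>r \<in> R. \<phi> v = \<phi> u \<otimes>\<^bsub>H\<^esub> r)"
    proof
      assume "\<exists>s \<in> S. v = u \<otimes>\<^bsub>G\<^esub> s"
      then obtain s where s: "s \<in> S" "v = u \<otimes>\<^bsub>G\<^esub> s" by blast
      have "\<pi> s \<in> R" using \<pi> s by (auto simp: colour_perm_def bij_betw_def)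
      then have "\<pi> s \<in> R" "inv\<^bsub>H\<^esub> (\<pi> s) \<in> R" using R_closed by auto
      then show "\<exists>r \<in> R. \<phi> v = \<phi> u \<otimes>\<^bsub>H\<^esub> r" using \<pi> s uv unfolding colour_perm_def by blast
    next
      assume "\<exists>r \<in> R. \<phi> v = \<phi> u \<otimes>\<^bsub>H\<^esub> r"
      then obtain s where s: "s \<in> S" "\<phi> v = \<phi> u \<otimes>\<^bsub>H\<^esub> \<pi> s"
        using \<pi> unfolding colour_perm_def bij_betw_def by blast
      obtain w where w: "w \<in> {s, inv\<^bsub>G\<^esub> s}" "\<phi> (u \<otimes>\<^bsub>G\<^esub> w) = \<phi> u \<otimes>\<^bsub>H\<^esub> \<pi> s"
        using colour_perm_surj[OF bij \<pi> uv(1) s(1)] by blast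
      have "w \<in> S" using w s S_closed by auto
      moreover from this have "v = u \<otimes>\<^bsub>G\<^esub> w"
        using inj_onD[OF bij_betw_imp_inj_on[OF bij]] w s uv S_closed by auto
      ultimately show "\<exists>s \<in> S. v = u \<otimes>\<^bsub>G\<^esub> s" by blast
    qed
    then show ?thesis
      using Cay_edge_iff[OF G.comm_group_axioms sym_S uv]
        Cay_edge_iff[OF H.comm_group_axioms sym_R \<phi>[OF uv(1)] \<phi>[OF uv(2)]] by simp
  qed
  then show "chromatic_iso G S H R \<phi>"
    using bij \<pi> unfolding chromatic_iso_def graph_iso_def colour_perm_def by (auto simp: Cay_def)
qed

text \<open>The inverse of \<open>\<pi>\<close> serves as colour permutation: by
  \<open>colour_perm_surj\<close>, the point \<open>\<phi> g + \<pi> s\<close> is the image of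
  \<open>g + s\<close> or of \<open>g - s\<close>, so the inverse map takes it to one of
  these.\<close>

lemma chromatic_iso_inv:
  assumes "chromatic_iso G S H R \<phi>"
  shows "chromatic_iso H R G S (inv_into (carrier G) \<phi>)"
proof -
  let ?\<theta> = "inv_into (carrier G) \<phi>"
  obtain \<pi> where bij: "bij_betw \<phi> (carrier G) (carrier H)" and \<pi>: "colour_perm G S H R \<phi> \<pi>"
    using assms chromatic_iso_iff by blast
  have bp: "bij_betw \<pi> S R" using \<pi> by (simp add: colour_perm_def)
  have \<theta>\<phi>: "?\<theta> (\<phi> x) = x" if "x \<in> carrier G" for x
    using bij that by (simp add: bij_betw_def)
  have \<pi>': "inv_into S \<pi> (\<pi> s) = s" if "s \<in> S" for s
    using bp that by (simp add: bij_betw_def)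
  have "inv_into S \<pi> (inv\<^bsub>H\<^esub> r) = inv\<^bsub>G\<^esub> (inv_into S \<pi> r)" if r: "r \<in> R" for r
  proof -
    obtain s where s: "s \<in> S" "r = \<pi> s" using bp r unfolding bij_betw_def by blast
    then have "inv\<^bsub>H\<^esub> r = \<pi> (inv\<^bsub>G\<^esub> s)" using \<pi> by (simp add: colour_perm_def)
    then show ?thesis using s \<pi>' S_closed by simp
  qed
  moreover have "?\<theta> (h \<otimes>\<^bsub>H\<^esub> r) \<in>
      {?\<theta> h \<otimes>\<^bsub>G\<^esub> inv_into S \<pi> r, ?\<theta> h \<otimes>\<^bsub>G\<^esub> inv\<^bsub>G\<^esub> (inv_into S \<pi> r)}"
    if hr: "h \<in> carrier H" "r \<in> R" for h r
  proof -
    obtain s where s: "s \<in> S" "r = \<pi> s" using bp hr unfolding bij_betw_def by blast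
    obtain g where g: "g \<in> carrier G" "h = \<phi> g" using bij hr unfolding bij_betw_def by blast
    obtain u where u: "u \<in> {s, inv\<^bsub>G\<^esub> s}" "\<phi> (g \<otimes>\<^bsub>G\<^esub> u) = \<phi> g \<otimes>\<^bsub>H\<^esub> \<pi> s"
      using colour_perm_surj[OF bij \<pi> g(1) s(1)] by blast
    have "g \<otimes>\<^bsub>G\<^esub> u \<in> carrier G" using u s g S_closed by auto
    then have "?\<theta> (h \<otimes>\<^bsub>H\<^esub> r) = g \<otimes>\<^bsub>G\<^esub> u" using \<theta>\<phi> u(2) s g by metis
    then show ?thesis using u(1) s \<pi>' g \<theta>\<phi> by auto
  qed
  ultimately have "colour_perm H R G S ?\<theta> (inv_into S \<pi>)"
    using bij_betw_inv_into[OF bp] by (simp add: colour_perm_def)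
  then show ?thesis
    using bij_betw_inv_into[OF bij] cayley_pair.chromatic_iso_iff[OF flip] by blast
qed

section \<open>Squares on which a chromatic isomorphism is not additive\<close>

text \<open>Here \<open>a\<close> and \<open>b\<close> are the actual increments of
  \<open>\<phi>\<close> along \<open>s\<close> and \<open>t\<close> at \<open>g\<close>, and the
  square at \<open>g\<close> fails to be additive. Walking round it both ways yields
  \<open>2a = 2b\<close>; the adjacent square at \<open>g\<close> spanned by \<open>-s\<close> and
  \<open>t\<close> then yields \<open>4a = 0\<close>. The conclusion lives in the target group and
  reaches the source through the inverse map.\<close>

lemma parallel_or_target_order_4:
  assumes bij: "bij_betw \<phi> (carrier G) (carrier H)" and \<pi>: "colour_perm G S H R \<phi> \<pi>"
    and g: "g \<in> carrier G" and s: "s \<in> S" and t: "t \<in> S" and ab: "a \<in> carrier H" "b \<in> carrier H"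
    and a: "\<phi> (g \<otimes>\<^bsub>G\<^esub> s) = \<phi> g \<otimes>\<^bsub>H\<^esub> a" and b: "\<phi> (g \<otimes>\<^bsub>G\<^esub> t) = \<phi> g \<otimes>\<^bsub>H\<^esub> b"
    and np: "\<phi> (g \<otimes>\<^bsub>G\<^esub> s \<otimes>\<^bsub>G\<^esub> t) \<noteq> \<phi> g \<otimes>\<^bsub>H\<^esub> a \<otimes>\<^bsub>H\<^esub> b"
  shows "a \<otimes>\<^bsub>H\<^esub> a \<noteq> \<one>\<^bsub>H\<^esub> \<and> a \<otimes>\<^bsub>H\<^esub> a \<otimes>\<^bsub>H\<^esub> (a \<otimes>\<^bsub>H\<^esub> a) = \<one>\<^bsub>H\<^esub> \<and> a \<otimes>\<^bsub>H\<^esub> a = b \<otimes>\<^bsub>H\<^esub> b"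
proof -
  have \<phi>: "\<phi> z \<in> carrier H" if "z \<in> carrier G" for z
    using bij that by (auto simp: bij_betw_def)
  have inj: "x = y" if "\<phi> x = \<phi> y" "x \<in> carrier G" "y \<in> carrier G" for x y
    using bij that by (auto simp: bij_betw_def dest: inj_onD)
  have sc: "s \<in> carrier G" "t \<in> carrier G" using S_closed s t by auto
  \<comment> \<open>The increment \<open>v\<close> seen at \<open>g\<close> is
    \<open>\<pi> u\<close> or its inverse, so at every point \<open>x\<close> a step along
    \<open>u\<close> or \<open>-u\<close> changes the value by \<open>v\<close> or
    \<open>-v\<close>. If \<open>2u = 0\<close>, then \<open>\<pi> u\<close> is its own inverse,
    whence \<open>2v = 0\<close>.\<close>
  have step: "\<phi> (x \<otimes>\<^bsub>G\<^esub> u) \<in> {\<phi> x \<otimes>\<^bsub>H\<^esub> v, \<phi> x \<otimes>\<^bsub>H\<^esub> inv\<^bsub>H\<^esub> v}"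
      "\<phi> (x \<otimes>\<^bsub>G\<^esub> inv\<^bsub>G\<^esub> u) \<in> {\<phi> x \<otimes>\<^bsub>H\<^esub> v, \<phi> x \<otimes>\<^bsub>H\<^esub> inv\<^bsub>H\<^esub> v}"
      "u \<otimes>\<^bsub>G\<^esub> u = \<one>\<^bsub>G\<^esub> \<Longrightarrow> v \<otimes>\<^bsub>H\<^esub> v = \<one>\<^bsub>H\<^esub>"
    if "u \<in> S" "x \<in> carrier G" "v \<in> carrier H" "\<phi> (g \<otimes>\<^bsub>G\<^esub> u) = \<phi> g \<otimes>\<^bsub>H\<^esub> v" for u v x
  proof -
    have pc: "\<pi> u \<in> carrier H" using \<pi> that R_closed(1) by (auto simp: colour_perm_def bij_betw_def)
    have uc: "u \<in> carrier G" "inv\<^bsub>G\<^esub> u \<in> S" using S_closed that by auto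
    have pi: "\<pi> (inv\<^bsub>G\<^esub> u) = inv\<^bsub>H\<^esub> (\<pi> u)" using \<pi> that by (simp add: colour_perm_def)
    have "\<phi> (g \<otimes>\<^bsub>G\<^esub> u) \<in> {\<phi> g \<otimes>\<^bsub>H\<^esub> \<pi> u, \<phi> g \<otimes>\<^bsub>H\<^esub> inv\<^bsub>H\<^esub> (\<pi> u)}"
      using \<pi> that(1) g unfolding colour_perm_def by blast
    then have v: "v = \<pi> u \<or> v = inv\<^bsub>H\<^esub> (\<pi> u)" using that g pc \<phi> by auto
    have "\<phi> (x \<otimes>\<^bsub>G\<^esub> w) \<in> {\<phi> x \<otimes>\<^bsub>H\<^esub> \<pi> w, \<phi> x \<otimes>\<^bsub>H\<^esub> inv\<^bsub>H\<^esub> (\<pi> w)}" if "w \<in> S" for w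
      using \<pi> that \<open>x \<in> carrier G\<close> by (simp add: colour_perm_def)
    from this[OF that(1)] this[OF uc(2)] v
    show "\<phi> (x \<otimes>\<^bsub>G\<^esub> u) \<in> {\<phi> x \<otimes>\<^bsub>H\<^esub> v, \<phi> x \<otimes>\<^bsub>H\<^esub> inv\<^bsub>H\<^esub> v}"
      "\<phi> (x \<otimes>\<^bsub>G\<^esub> inv\<^bsub>G\<^esub> u) \<in> {\<phi> x \<otimes>\<^bsub>H\<^esub> v, \<phi> x \<otimes>\<^bsub>H\<^esub> inv\<^bsub>H\<^esub> v}"
      unfolding pi using pc by auto
    assume "u \<otimes>\<^bsub>G\<^esub> u = \<one>\<^bsub>G\<^esub>"
    then have "inv\<^bsub>G\<^esub> u = u" using uc G.inv_equality by blast
    then have "\<pi> u = inv\<^bsub>H\<^esub> (\<pi> u)" using pi by simp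
    then show "v \<otimes>\<^bsub>H\<^esub> v = \<one>\<^bsub>H\<^esub>" using v pc by (metis H.r_inv)
  qed
  have cl: "\<phi> g \<in> carrier H" "g \<otimes>\<^bsub>G\<^esub> s \<in> carrier G" "g \<otimes>\<^bsub>G\<^esub> t \<in> carrier G"
    "g \<otimes>\<^bsub>G\<^esub> inv\<^bsub>G\<^esub> s \<in> carrier G" using g sc \<phi> by auto
  \<comment> \<open>The way through \<open>g + s\<close>: the increment along \<open>t\<close> is
    \<open>b\<close> or \<open>-b\<close>, and \<open>b\<close> is excluded by
    \<open>np\<close>.\<close>
  have st: "\<phi> (g \<otimes>\<^bsub>G\<^esub> s \<otimes>\<^bsub>G\<^esub> t) = \<phi> g \<otimes>\<^bsub>H\<^esub> a \<otimes>\<^bsub>H\<^esub> inv\<^bsub>H\<^esub> b"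
    using step(1)[OF t cl(2) ab(2) b] np by (simp add: a)
  have ts_eq: "g \<otimes>\<^bsub>G\<^esub> t \<otimes>\<^bsub>G\<^esub> s = g \<otimes>\<^bsub>G\<^esub> s \<otimes>\<^bsub>G\<^esub> t" using g sc by (simp add: G.m_ac)
  \<comment> \<open>The way through \<open>g + t\<close>: for the same reason the increment along
    \<open>s\<close> must be \<open>-a\<close>.\<close>
  have ts: "\<phi> (g \<otimes>\<^bsub>G\<^esub> s \<otimes>\<^bsub>G\<^esub> t) = \<phi> g \<otimes>\<^bsub>H\<^esub> b \<otimes>\<^bsub>H\<^esub> inv\<^bsub>H\<^esub> a"
    using step(1)[OF s cl(3) ab(1) a] np ab cl unfolding ts_eq b by (auto simp: H.m_ac)
  have "a \<otimes>\<^bsub>H\<^esub> inv\<^bsub>H\<^esub> b = b \<otimes>\<^bsub>H\<^esub> inv\<^bsub>H\<^esub> a" using st ts ab cl by (simp add: H.m_assoc)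
  \<comment> \<open>Adding \<open>a + b\<close> to both sides turns \<open>a - b = b - a\<close>
    into \<open>2a = 2b\<close>.\<close>
  then have "a \<otimes>\<^bsub>H\<^esub> inv\<^bsub>H\<^esub> b \<otimes>\<^bsub>H\<^esub> (a \<otimes>\<^bsub>H\<^esub> b) = b \<otimes>\<^bsub>H\<^esub> inv\<^bsub>H\<^esub> a \<otimes>\<^bsub>H\<^esub> (a \<otimes>\<^bsub>H\<^esub> b)" by simp
  moreover have "a \<otimes>\<^bsub>H\<^esub> inv\<^bsub>H\<^esub> b \<otimes>\<^bsub>H\<^esub> (a \<otimes>\<^bsub>H\<^esub> b) = a \<otimes>\<^bsub>H\<^esub> a"
    using ab by (metis H.inv_closed H.m_closed H.inv_solve_right' H.m_assoc H.m_comm)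
  moreover have "b \<otimes>\<^bsub>H\<^esub> inv\<^bsub>H\<^esub> a \<otimes>\<^bsub>H\<^esub> (a \<otimes>\<^bsub>H\<^esub> b) = b \<otimes>\<^bsub>H\<^esub> b"
    using ab H.m_assoc[of "inv\<^bsub>H\<^esub> a" a b] by (simp add: H.m_assoc)
  ultimately have aabb: "a \<otimes>\<^bsub>H\<^esub> a = b \<otimes>\<^bsub>H\<^esub> b" by simp
  \<comment> \<open>If \<open>a\<close> were its own inverse, the value found in \<open>ts\<close>
    would be the excluded one.\<close>
  have aa: "a \<otimes>\<^bsub>H\<^esub> a \<noteq> \<one>\<^bsub>H\<^esub>"
  proof
    assume "a \<otimes>\<^bsub>H\<^esub> a = \<one>\<^bsub>H\<^esub>"
    then have "inv\<^bsub>H\<^esub> a = a" using ab H.inv_equality by blast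
    then show False using ts np ab cl by (simp add: H.m_ac)
  qed
  then have ss: "s \<otimes>\<^bsub>G\<^esub> s \<noteq> \<one>\<^bsub>G\<^esub>" using step(3)[OF s g ab(1) a] by blast
  then have sne: "inv\<^bsub>G\<^esub> s \<noteq> s" using sc by (metis G.r_inv)
  \<comment> \<open>Since \<open>2a\<close> is nonzero, so is \<open>2s\<close>. Thus
    \<open>g + s\<close> and \<open>g - s\<close> differ, and by injectivity they take different
    values among \<open>\<phi> g + a\<close> and \<open>\<phi> g - a\<close>.\<close>
  have ms: "\<phi> (g \<otimes>\<^bsub>G\<^esub> inv\<^bsub>G\<^esub> s) = \<phi> g \<otimes>\<^bsub>H\<^esub> inv\<^bsub>H\<^esub> a"
  proof -
    have "\<phi> (g \<otimes>\<^bsub>G\<^esub> inv\<^bsub>G\<^esub> s) \<noteq> \<phi> (g \<otimes>\<^bsub>G\<^esub> s)" using inj cl g sc sne by (metis G.inv_closed G.l_cancel)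
    then show ?thesis using step(2)[OF s g ab(1) a] a by auto
  qed
  \<comment> \<open>The same at \<open>g + t\<close>: the step along \<open>s\<close> used up
    \<open>-a\<close>, so the step along \<open>-s\<close> has increment \<open>a\<close>.\<close>
  have tms: "\<phi> (g \<otimes>\<^bsub>G\<^esub> t \<otimes>\<^bsub>G\<^esub> inv\<^bsub>G\<^esub> s) = \<phi> g \<otimes>\<^bsub>H\<^esub> b \<otimes>\<^bsub>H\<^esub> a"
  proof -
    have "\<phi> (g \<otimes>\<^bsub>G\<^esub> t \<otimes>\<^bsub>G\<^esub> inv\<^bsub>G\<^esub> s) \<noteq> \<phi> (g \<otimes>\<^bsub>G\<^esub> t \<otimes>\<^bsub>G\<^esub> s)"
      using inj cl g sc sne by (metis G.inv_closed G.l_cancel G.m_closed)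
    then show ?thesis using step(2)[OF s cl(3) ab(1) a] ts unfolding ts_eq b by auto
  qed
  \<comment> \<open>The same corner is now reached through \<open>g - s\<close>. Comparison gives
    either \<open>a = -a\<close>, which is impossible, or \<open>a + b = -(a + b)\<close>, hence
    \<open>2a + 2b = 0\<close>.\<close>
  have "g \<otimes>\<^bsub>G\<^esub> inv\<^bsub>G\<^esub> s \<otimes>\<^bsub>G\<^esub> t = g \<otimes>\<^bsub>G\<^esub> t \<otimes>\<^bsub>G\<^esub> inv\<^bsub>G\<^esub> s" using g sc by (simp add: G.m_ac)
  then have "\<phi> g \<otimes>\<^bsub>H\<^esub> b \<otimes>\<^bsub>H\<^esub> a \<in>
      {\<phi> g \<otimes>\<^bsub>H\<^esub> inv\<^bsub>H\<^esub> a \<otimes>\<^bsub>H\<^esub> b, \<phi> g \<otimes>\<^bsub>H\<^esub> inv\<^bsub>H\<^esub> a \<otimes>\<^bsub>H\<^esub> inv\<^bsub>H\<^esub> b}"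
    using step(1)[OF t cl(4) ab(2) b] tms ms by simp
  then consider "b \<otimes>\<^bsub>H\<^esub> a = b \<otimes>\<^bsub>H\<^esub> inv\<^bsub>H\<^esub> a" | "b \<otimes>\<^bsub>H\<^esub> a = inv\<^bsub>H\<^esub> (b \<otimes>\<^bsub>H\<^esub> a)"
    using ab cl by (auto simp: H.m_assoc H.inv_mult H.m_comm[of "inv\<^bsub>H\<^esub> a"])
  then have "a \<otimes>\<^bsub>H\<^esub> a \<otimes>\<^bsub>H\<^esub> (b \<otimes>\<^bsub>H\<^esub> b) = \<one>\<^bsub>H\<^esub>"
  proof cases
    case 1
    then have "a = inv\<^bsub>H\<^esub> a" using ab by simp
    then show ?thesis using aa ab by (metis H.r_inv)
  next
    case 2
    then have "(b \<otimes>\<^bsub>H\<^esub> a) \<otimes>\<^bsub>H\<^esub> (b \<otimes>\<^bsub>H\<^esub> a) = \<one>\<^bsub>H\<^esub>" using ab by (metis H.m_closed H.r_inv)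
    then show ?thesis using ab by (simp add: H.m_ac)
  qed
  then show ?thesis using aa aabb by simp
qed

text \<open>The previous lemma is applied to the inverse map at the point \<open>\<phi> g\<close>:
  there \<open>s\<close> and \<open>t\<close> are the increments along \<open>a\<close> and
  \<open>b\<close>, so its conclusion concerns \<open>s\<close> and \<open>t\<close>
  themselves.\<close>

lemma parallel_or_order_4:
  assumes "chromatic_iso G S H R \<phi>" and s: "s \<in> S" and t: "t \<in> S" and np: "t \<notin> parallel G H \<phi> s"
  shows "s [^]\<^bsub>G\<^esub> (2::nat) = t [^]\<^bsub>G\<^esub> (2::nat)" "group.ord G s = 4"
proof -
  let ?\<theta> = "inv_into (carrier G) \<phi>"
  obtain \<pi> where bij: "bij_betw \<phi> (carrier G) (carrier H)" and \<pi>: "colour_perm G S H R \<phi> \<pi>"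
    using assms chromatic_iso_iff by blast
  obtain \<rho> where bij': "bij_betw ?\<theta> (carrier H) (carrier G)" and \<rho>: "colour_perm H R G S ?\<theta> \<rho>"
    using chromatic_iso_inv[OF assms(1)] cayley_pair.chromatic_iso_iff[OF flip] by blast
  have \<phi>: "\<phi> z \<in> carrier H" if "z \<in> carrier G" for z
    using bij that by (auto simp: bij_betw_def)
  have \<theta>\<phi>: "?\<theta> (\<phi> x) = x" if "x \<in> carrier G" for x
    using bij that by (simp add: bij_betw_def)
  have \<phi>\<theta>: "\<phi> (?\<theta> y) = y" if "y \<in> carrier H" for y
    using bij that by (simp add: bij_betw_def f_inv_into_f)
  have sc: "s \<in> carrier G" "t \<in> carrier G" using S_closed s t by auto
  then obtain g where g: "g \<in> carrier G"
    and ne: "\<phi> (g \<otimes>\<^bsub>G\<^esub> s \<otimes>\<^bsub>G\<^esub> t) \<otimes>\<^bsub>H\<^esub> \<phi> g \<noteq> \<phi> (g \<otimes>\<^bsub>G\<^esub> s) \<otimes>\<^bsub>H\<^esub> \<phi> (g \<otimes>\<^bsub>G\<^esub> t)"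
    using np by (auto simp: parallel_def)
  have ex: "\<exists>v \<in> R. \<phi> (g \<otimes>\<^bsub>G\<^esub> u) = \<phi> g \<otimes>\<^bsub>H\<^esub> v" if "u \<in> S" for u
  proof -
    have "\<pi> u \<in> R" using \<pi> that by (auto simp: colour_perm_def bij_betw_def)
    then have "\<pi> u \<in> R" "inv\<^bsub>H\<^esub> (\<pi> u) \<in> R" using R_closed by auto
    then show ?thesis using \<pi> that g unfolding colour_perm_def by blast
  qed
  obtain a b where ab: "a \<in> R" "\<phi> (g \<otimes>\<^bsub>G\<^esub> s) = \<phi> g \<otimes>\<^bsub>H\<^esub> a" "b \<in> R" "\<phi> (g \<otimes>\<^bsub>G\<^esub> t) = \<phi> g \<otimes>\<^bsub>H\<^esub> b"
    using ex s t by metis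
  have abc: "a \<in> carrier H" "b \<in> carrier H" using ab R_closed by auto
  have "?\<theta> (\<phi> g \<otimes>\<^bsub>H\<^esub> a \<otimes>\<^bsub>H\<^esub> b) \<noteq> ?\<theta> (\<phi> g) \<otimes>\<^bsub>G\<^esub> s \<otimes>\<^bsub>G\<^esub> t"
  proof
    assume "?\<theta> (\<phi> g \<otimes>\<^bsub>H\<^esub> a \<otimes>\<^bsub>H\<^esub> b) = ?\<theta> (\<phi> g) \<otimes>\<^bsub>G\<^esub> s \<otimes>\<^bsub>G\<^esub> t"
    then have "\<phi> (g \<otimes>\<^bsub>G\<^esub> s \<otimes>\<^bsub>G\<^esub> t) = \<phi> g \<otimes>\<^bsub>H\<^esub> a \<otimes>\<^bsub>H\<^esub> b"
      using \<theta>\<phi>[OF g] \<phi>\<theta>[of "\<phi> g \<otimes>\<^bsub>H\<^esub> a \<otimes>\<^bsub>H\<^esub> b"] \<phi>[OF g] abc by simp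
    then show False using ne ab abc \<phi>[OF g] by (simp add: H.m_ac)
  qed
  moreover have "?\<theta> (\<phi> g \<otimes>\<^bsub>H\<^esub> a) = ?\<theta> (\<phi> g) \<otimes>\<^bsub>G\<^esub> s" "?\<theta> (\<phi> g \<otimes>\<^bsub>H\<^esub> b) = ?\<theta> (\<phi> g) \<otimes>\<^bsub>G\<^esub> t"
    using ab \<theta>\<phi> g sc by (metis G.m_closed)+
  ultimately have *: "s \<otimes>\<^bsub>G\<^esub> s \<noteq> \<one>\<^bsub>G\<^esub> \<and> s \<otimes>\<^bsub>G\<^esub> s \<otimes>\<^bsub>G\<^esub> (s \<otimes>\<^bsub>G\<^esub> s) = \<one>\<^bsub>G\<^esub> \<and> s \<otimes>\<^bsub>G\<^esub> s = t \<otimes>\<^bsub>G\<^esub> t"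
    using cayley_pair.parallel_or_target_order_4[OF flip bij' \<rho> \<phi>[OF g] ab(1) ab(3) sc] by blast
  then show "s [^]\<^bsub>G\<^esub> (2::nat) = t [^]\<^bsub>G\<^esub> (2::nat)" using sc by (simp add: numeral_2_eq_2)
  have "s [^]\<^bsub>G\<^esub> (4::nat) = \<one>\<^bsub>G\<^esub>" "s [^]\<^bsub>G\<^esub> (2::nat) \<noteq> \<one>\<^bsub>G\<^esub>"
    using conjunct1[OF *] conjunct1[OF conjunct2[OF *]] sc(1)
    by (simp_all add: numeral_eq_Suc G.m_assoc)
  \<comment> \<open>The order divides 4 but not 2, so as a power of 2 it is 4.\<close>
  then have "G.ord s dvd 2 ^ 2" "\<not> G.ord s dvd 2" using sc by (simp_all add: G.pow_eq_id)
  then obtain i where i: "i \<le> 2" "G.ord s = 2 ^ i" using divides_primepow_nat two_is_prime_nat by blast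
  with \<open>\<not> G.ord s dvd 2\<close> have "i = 2"
    by (metis One_nat_def dvd_refl le_SucE le_zero_eq numeral_2_eq_2 one_dvd power_0 power_one_right)
  then show "G.ord s = 4" using i by simp
qed

text \<open>After an increment \<open>a\<close> along \<open>s\<close>, the next one along
  \<open>s\<close> is \<open>a\<close> or \<open>-a\<close>. In the second case the value returns to
  \<open>\<phi> g\<close>, so \<open>2s = 0\<close> by injectivity, and then \<open>a = -a\<close>
  anyway.\<close>

lemma parallel_self:
  assumes "chromatic_iso G S H R \<phi>" and s: "s \<in> S"
  shows "s \<in> parallel G H \<phi> s"
proof -
  obtain \<pi> where bij: "bij_betw \<phi> (carrier G) (carrier H)" and \<pi>: "colour_perm G S H R \<phi> \<pi>"
    using assms chromatic_iso_iff by blast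
  have \<phi>: "\<phi> z \<in> carrier H" if "z \<in> carrier G" for z
    using bij that by (auto simp: bij_betw_def)
  have sc: "s \<in> carrier G" using S_closed s by auto
  have pc: "\<pi> s \<in> carrier H" using \<pi> s R_closed(1) by (auto simp: colour_perm_def bij_betw_def)
  have pi: "\<pi> (inv\<^bsub>G\<^esub> s) = inv\<^bsub>H\<^esub> (\<pi> s)" using \<pi> s by (simp add: colour_perm_def)
  have "\<phi> (g \<otimes>\<^bsub>G\<^esub> s \<otimes>\<^bsub>G\<^esub> s) \<otimes>\<^bsub>H\<^esub> \<phi> g = \<phi> (g \<otimes>\<^bsub>G\<^esub> s) \<otimes>\<^bsub>H\<^esub> \<phi> (g \<otimes>\<^bsub>G\<^esub> s)" if g: "g \<in> carrier G" for g
  proof -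
    have st: "\<phi> (x \<otimes>\<^bsub>G\<^esub> s) \<in> {\<phi> x \<otimes>\<^bsub>H\<^esub> \<pi> s, \<phi> x \<otimes>\<^bsub>H\<^esub> inv\<^bsub>H\<^esub> (\<pi> s)}" if "x \<in> carrier G" for x
      using \<pi> that s by (simp add: colour_perm_def)
    have gs: "g \<otimes>\<^bsub>G\<^esub> s \<in> carrier G" using g sc by simp
    obtain a where a: "a \<in> {\<pi> s, inv\<^bsub>H\<^esub> (\<pi> s)}" "\<phi> (g \<otimes>\<^bsub>G\<^esub> s) = \<phi> g \<otimes>\<^bsub>H\<^esub> a"
      using st[OF g] by blast
    have ac: "a \<in> carrier H" using a pc by auto
    have "\<phi> (g \<otimes>\<^bsub>G\<^esub> s \<otimes>\<^bsub>G\<^esub> s) = \<phi> (g \<otimes>\<^bsub>G\<^esub> s) \<otimes>\<^bsub>H\<^esub> a"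
    proof (rule ccontr)
      assume no: "\<not> ?thesis"
      then have "\<phi> (g \<otimes>\<^bsub>G\<^esub> s \<otimes>\<^bsub>G\<^esub> s) = \<phi> (g \<otimes>\<^bsub>G\<^esub> s) \<otimes>\<^bsub>H\<^esub> inv\<^bsub>H\<^esub> a"
        using st[OF gs] a(1) pc by auto
      also have "\<dots> = \<phi> g" using a(2) ac \<phi>[OF g] by (simp add: H.m_assoc)
      finally have "g \<otimes>\<^bsub>G\<^esub> s \<otimes>\<^bsub>G\<^esub> s = g" using inj_onD[OF bij_betw_imp_inj_on[OF bij]] g sc by simp
      then have "s \<otimes>\<^bsub>G\<^esub> s = \<one>\<^bsub>G\<^esub>" using g sc by (simp add: G.m_assoc)
      then have "inv\<^bsub>G\<^esub> s = s" using sc G.inv_equality by blast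
      then have "\<pi> s = inv\<^bsub>H\<^esub> (\<pi> s)" using pi by simp
      then show False using no st[OF gs] a(1) by auto
    qed
    then show ?thesis using a(2) ac \<phi>[OF g] \<phi>[OF gs] by (simp add: H.m_ac)
  qed
  then show ?thesis using sc by (simp add: parallel_def)
qed

end

section \<open>Affine maps in terms of parallelism\<close>

lemma affine_mapI:
  assumes "comm_group G" "comm_group H" and bij: "bij_betw \<phi> (carrier G) (carrier H)"
    and par: "\<And>x. x \<in> carrier G \<Longrightarrow> parallel G H \<phi> x = carrier G"
  shows "affine_map G H \<phi>"
proof -
  interpret G: comm_group G by fact
  interpret H: comm_group H by fact
  have \<phi>: "\<phi> z \<in> carrier H" if "z \<in> carrier G" for z
    using bij that by (auto simp: bij_betw_def)
  \<comment> \<open>The candidate isomorphism is \<open>\<phi>\<close> translated so that the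
    identity goes to the identity. Parallelism, read at the base point \<open>\<one>\<close>, is
    exactly its additivity.\<close>
  let ?h = "\<phi> \<one>\<^bsub>G\<^esub>"
  let ?\<tau> = "\<lambda>x. \<phi> x \<otimes>\<^bsub>H\<^esub> inv\<^bsub>H\<^esub> ?h"
  have h: "?h \<in> carrier H" by (simp add: \<phi>)
  have eq: "\<phi> (x \<otimes>\<^bsub>G\<^esub> y) \<otimes>\<^bsub>H\<^esub> ?h = \<phi> x \<otimes>\<^bsub>H\<^esub> \<phi> y" if xy: "x \<in> carrier G" "y \<in> carrier G" for x y
  proof -
    have "y \<in> parallel G H \<phi> x" using par xy by simp
    then have "\<phi> (\<one>\<^bsub>G\<^esub> \<otimes>\<^bsub>G\<^esub> x \<otimes>\<^bsub>G\<^esub> y) \<otimes>\<^bsub>H\<^esub> ?h = \<phi> (\<one>\<^bsub>G\<^esub> \<otimes>\<^bsub>G\<^esub> x) \<otimes>\<^bsub>H\<^esub> \<phi> (\<one>\<^bsub>G\<^esub> \<otimes>\<^bsub>G\<^esub> y)"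
      unfolding parallel_def by blast
    then show ?thesis using xy by simp
  qed
  have "?\<tau> (x \<otimes>\<^bsub>G\<^esub> y) = ?\<tau> x \<otimes>\<^bsub>H\<^esub> ?\<tau> y" if xy: "x \<in> carrier G" "y \<in> carrier G" for x y
  proof -
    have "?\<tau> x \<otimes>\<^bsub>H\<^esub> ?\<tau> y = (\<phi> x \<otimes>\<^bsub>H\<^esub> \<phi> y) \<otimes>\<^bsub>H\<^esub> inv\<^bsub>H\<^esub> ?h \<otimes>\<^bsub>H\<^esub> inv\<^bsub>H\<^esub> ?h"
      using xy \<phi> h by (simp add: H.m_ac)
    also have "\<dots> = \<phi> (x \<otimes>\<^bsub>G\<^esub> y) \<otimes>\<^bsub>H\<^esub> (?h \<otimes>\<^bsub>H\<^esub> inv\<^bsub>H\<^esub> ?h) \<otimes>\<^bsub>H\<^esub> inv\<^bsub>H\<^esub> ?h"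
      unfolding eq[OF xy, symmetric] using xy h \<phi>[of "x \<otimes>\<^bsub>G\<^esub> y"] by (simp add: H.m_assoc)
    also have "\<dots> = ?\<tau> (x \<otimes>\<^bsub>G\<^esub> y)" using xy h \<phi>[of "x \<otimes>\<^bsub>G\<^esub> y"] by simp
    finally show ?thesis by simp
  qed
  moreover have "bij_betw ?\<tau> (carrier G) (carrier H)"
  proof -
    have "bij_betw (\<lambda>y. y \<otimes>\<^bsub>H\<^esub> inv\<^bsub>H\<^esub> ?h) (carrier H) (carrier H)"
      by (rule bij_betwI[where g = "\<lambda>y. y \<otimes>\<^bsub>H\<^esub> ?h"]) (use h in \<open>auto simp: H.m_assoc\<close>)
    then show ?thesis using bij_betw_trans[OF bij] by (simp add: o_def)
  qed
  ultimately have "?\<tau> \<in> iso G H" using \<phi> h by (auto simp: iso_def hom_def)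
  moreover have "\<phi> x = ?\<tau> x \<otimes>\<^bsub>H\<^esub> ?h" if "x \<in> carrier G" for x
    using that \<phi> h by (simp add: H.m_assoc)
  ultimately show ?thesis
    unfolding affine_map_def using bij h by (intro conjI bexI[of _ ?h] bexI[of _ ?\<tau>] ballI)
qed

lemma affine_map_parallel:
  assumes "comm_group G" "comm_group H" "affine_map G H \<phi>" "x \<in> carrier G"
  shows "parallel G H \<phi> x = carrier G"
proof -
  interpret G: comm_group G by fact
  interpret H: comm_group H by fact
  obtain \<tau> h where \<tau>: "\<tau> \<in> iso G H" "h \<in> carrier H"
    "\<And>x. x \<in> carrier G \<Longrightarrow> \<phi> x = \<tau> x \<otimes>\<^bsub>H\<^esub> h"
    using assms(3) by (auto simp: affine_map_def)
  have hom: "\<tau> \<in> hom G H" using \<tau>(1) by (simp add: iso_def)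
  have "\<phi> (g \<otimes>\<^bsub>G\<^esub> x \<otimes>\<^bsub>G\<^esub> y) \<otimes>\<^bsub>H\<^esub> \<phi> g = \<phi> (g \<otimes>\<^bsub>G\<^esub> x) \<otimes>\<^bsub>H\<^esub> \<phi> (g \<otimes>\<^bsub>G\<^esub> y)"
    if "y \<in> carrier G" "g \<in> carrier G" for y g
    using that assms(4) \<tau>(2) hom_in_carrier[OF hom]
    by (simp add: \<tau>(3) hom_mult[OF hom] H.m_ac)
  then show ?thesis by (auto simp: parallel_def)
qed

section \<open>Cosets and index at most 2\<close>

context group
begin

text \<open>Otherwise \<open>H\<close>, \<open>H #> s\<close> and \<open>H #> x\<close> would be
  three distinct cosets.\<close>

lemma index_le_2D:
  assumes "subgroup H G" "index_le G H 2" "s \<in> carrier G" "s \<notin> H" "x \<in> carrier G"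
  shows "x \<in> H \<or> x \<in> H #> s"
proof (rule ccontr)
  assume no: "\<not> ?thesis"
  have "H \<in> rcosets H" using assms(1) using is_group by (simp add: subgroup.subgroup_in_rcosets)
  moreover have "H #> s \<in> rcosets H" "H #> x \<in> rcosets H"
    using assms subgroup.subset by (auto intro!: rcosetsI)
  ultimately have "{H, H #> s, H #> x} \<subseteq> rcosets H" by blast
  moreover have "x \<in> H #> x" "s \<in> H #> s" using assms rcos_self by blast+
  then have "card {H, H #> s, H #> x} = 3" using no assms by (auto simp: card_insert_if)
  moreover have "finite (rcosets H)" "card (rcosets H) \<le> 2"
    using assms(2) by (simp_all add: index_le_def)
  ultimately show False using card_mono[of "rcosets H" "{H, H #> s, H #> x}"] by simp
qed

text \<open>A large index means that no two cosets exhaust the group, which leaves room for two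
  elements outside \<open>H\<close> whose product also avoids \<open>H\<close>. These will witness
  that additivity fails.\<close>

lemma not_index_le_2D:
  assumes H: "subgroup H G" and "\<not> index_le G H 2"
  obtains x y where "x \<in> carrier G" "y \<in> carrier G" "x \<notin> H" "y \<notin> H" "x \<otimes> y \<notin> H"
proof -
  have *: "\<not> rcosets H \<subseteq> {H, K}" for K
  proof
    assume sub: "rcosets H \<subseteq> {H, K}"
    then have "finite (rcosets H)" by (rule finite_subset) simp
    moreover have "card (rcosets H) \<le> card {H, K}" using sub by (intro card_mono) auto
    moreover have "card {H, K} \<le> 2" by (simp add: card_insert_if)
    ultimately show False using assms(2) by (simp add: index_le_def)
  qed
  obtain x where "x \<in> carrier G" "H #> x \<noteq> H"
    using *[of H] by (auto simp: RCOSETS_def)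
  then have x: "x \<in> carrier G" "x \<notin> H" using H by (auto simp: coset_join2)
  \<comment> \<open>Avoiding the coset of \<open>inv x\<close> is what keeps
    \<open>y \<otimes> x\<close> out of \<open>H\<close>.\<close>
  obtain y where y: "y \<in> carrier G" "H #> y \<noteq> H" "H #> y \<noteq> H #> inv x"
    using *[of "H #> inv x"] by (auto simp: RCOSETS_def)
  have "y \<notin> H" using y H by (auto simp: coset_join2)
  moreover have "y \<otimes> x \<notin> H"
  proof
    assume "y \<otimes> x \<in> H"
    then have "y \<otimes> x \<otimes> inv x \<in> H #> inv x" by (auto simp: r_coset_def)
    then have "y \<in> H #> inv x" using x y by (simp add: m_assoc)
    then show False using repr_independence[OF _ _ H] x y by force
  qed
  ultimately show thesis using that x y by blast
qed

end

lemma subgroup_generate_T_set: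
  assumes "comm_group G" "symmetric_subset G S" "s \<in> S"
  shows "subgroup (generate G (T_set G S (s [^]\<^bsub>G\<^esub> (2::nat)))) G"
proof -
  interpret G: comm_group G by fact
  have "s \<in> carrier G" using symmetric_subsetD[OF assms(2,3)] by simp
  then show ?thesis
    using symmetric_subsetD(1)[OF assms(2)] by (auto intro!: G.generate_is_subgroup simp: T_set_def)
qed

section \<open>Small index makes every chromatic isomorphism affine\<close>

context cayley_pair
begin

text \<open>The elements parallel to \<open>s\<close> form a subgroup, so generators suffice:
  \<open>2s\<close> qualifies because \<open>s\<close> is parallel to itself, and any
  \<open>t\<close> with \<open>2t\<close> different from \<open>2s\<close> by
  \<open>parallel_or_order_4\<close>.\<close>

lemma generate_T_set_parallel:
  assumes chr: "chromatic_iso G S H R \<phi>" and s: "s \<in> S"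
  shows "generate G (T_set G S (s [^]\<^bsub>G\<^esub> (2::nat))) \<subseteq> parallel G H \<phi> s"
proof (rule G.generate_subgroup_incl)
  have "\<phi> \<in> carrier G \<rightarrow> carrier H" using chr chromatic_iso_iff by (auto simp: bij_betw_def)
  then show sub: "subgroup (parallel G H \<phi> s) G"
    using S_closed s by (intro subgroup_parallel G.comm_group_axioms H.comm_group_axioms) auto
  have self: "s \<in> parallel G H \<phi> s" by (rule parallel_self[OF chr s])
  have "s [^]\<^bsub>G\<^esub> (2::nat) \<in> parallel G H \<phi> s"
    using subgroup.m_closed[OF sub self self] S_closed(1)[OF s] by (simp add: numeral_2_eq_2)
  then show "T_set G S (s [^]\<^bsub>G\<^esub> (2::nat)) \<subseteq> parallel G H \<phi> s"
    using parallel_or_order_4(1)[OF chr s] by (force simp: T_set_def)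
qed

lemma affine_if_index_le_2:
  assumes con: "connected_graph (Cay G S)" and chr: "chromatic_iso G S H R \<phi>"
    and idx: "\<forall>s \<in> S. group.ord G s = 4 \<longrightarrow>
      index_le G (generate G (T_set G S (s [^]\<^bsub>G\<^esub> (2::nat)))) 2"
  shows "affine_map G H \<phi>"
proof -
  have bij: "bij_betw \<phi> (carrier G) (carrier H)" using chr chromatic_iso_iff by blast
  then have \<phi>: "\<phi> \<in> carrier G \<rightarrow> carrier H" by (auto simp: bij_betw_def)
  note sub = subgroup_parallel[OF G.comm_group_axioms H.comm_group_axioms \<phi>]
  note sym = parallel_sym[OF G.comm_group_axioms H.comm_group_axioms \<phi>]
  have gen: "carrier G \<subseteq> P" if "subgroup P G" "S \<subseteq> P" for P
    using G.generate_subgroup_incl[OF that(2,1)]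
      generate_of_connected_Cay[OF G.comm_group_axioms sym_S con] by simp
  have SS: "t \<in> parallel G H \<phi> s" if s: "s \<in> S" and t: "t \<in> S" for s t
  proof (rule ccontr)
    assume np: "t \<notin> parallel G H \<phi> s"
    let ?H = "generate G (T_set G S (s [^]\<^bsub>G\<^esub> (2::nat)))"
    have sc: "s \<in> carrier G" "t \<in> carrier G" using S_closed s t by auto
    note o4 = parallel_or_order_4[OF chr s t np]
    have Hs: "?H \<subseteq> parallel G H \<phi> s" by (rule generate_T_set_parallel[OF chr s])
    \<comment> \<open>As \<open>2s = 2t\<close>, both elements define the same subgroup. If it
      contained \<open>s\<close>, then \<open>s\<close> would be parallel to \<open>t\<close>,
      against the choice of \<open>t\<close>.\<close>
    have "?H \<subseteq> parallel G H \<phi> t" unfolding o4(1) by (rule generate_T_set_parallel[OF chr t])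
    then have "s \<notin> ?H" using np sym[OF sc(2)] by blast
    then have "t \<in> ?H \<or> t \<in> ?H #>\<^bsub>G\<^esub> s"
      using G.index_le_2D[OF subgroup_generate_T_set[OF G.comm_group_axioms sym_S s] _ sc(1) _ sc(2)]
        idx s o4(2) by blast
    moreover have "?H #>\<^bsub>G\<^esub> s \<subseteq> parallel G H \<phi> s"
      using Hs subgroup.m_closed[OF sub[OF sc(1)]] parallel_self[OF chr s] by (auto simp: r_coset_def)
    ultimately show False using Hs np by blast
  qed
  \<comment> \<open>Parallelism spreads from \<open>S\<close> to the group in two rounds. For fixed
    \<open>s\<close> the subgroup parallel to \<open>s\<close> contains \<open>S\<close>, hence
    everything; by symmetry the subgroup parallel to an arbitrary \<open>x\<close> contains
    \<open>S\<close>, hence everything.\<close>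
  have Sx: "s \<in> parallel G H \<phi> x" if "s \<in> S" "x \<in> carrier G" for s x
    using gen[OF sub[of s]] SS that S_closed(1) by (blast intro: sym)
  have "parallel G H \<phi> x = carrier G" if "x \<in> carrier G" for x
    using gen[OF sub[OF that]] Sx that by (auto simp: parallel_def)
  then show ?thesis by (rule affine_mapI[OF G.comm_group_axioms H.comm_group_axioms bij])
qed

section \<open>Large index yields a non-affine chromatic isomorphism\<close>

lemma chromatic_iso_comp:
  assumes "chromatic_iso G S G S \<psi>" "chromatic_iso G S H R \<phi>"
  shows "chromatic_iso G S H R (\<phi> \<circ> \<psi>)"
proof -
  note iff = cayley_pair.chromatic_iso_iff[OF cayley_pair_self]
  obtain \<pi> where b1: "bij_betw \<psi> (carrier G) (carrier G)" and \<pi>: "colour_perm G S G S \<psi> \<pi>"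
    using assms(1) iff by blast
  obtain \<rho> where b2: "bij_betw \<phi> (carrier G) (carrier H)" and \<rho>: "colour_perm G S H R \<phi> \<rho>"
    using assms(2) chromatic_iso_iff by blast
  have \<pi>S: "\<pi> s \<in> S" "\<rho> (\<pi> s) \<in> carrier H" if "s \<in> S" for s
    using \<pi> \<rho> that R_closed(1) by (auto simp: colour_perm_def bij_betw_def)
  have \<psi>: "\<psi> g \<in> carrier G" if "g \<in> carrier G" for g using b1 that by (auto simp: bij_betw_def)
  have "(\<phi> \<circ> \<psi>) (g \<otimes>\<^bsub>G\<^esub> s) \<in> {(\<phi> \<circ> \<psi>) g \<otimes>\<^bsub>H\<^esub> (\<rho> \<circ> \<pi>) s, (\<phi> \<circ> \<psi>) g \<otimes>\<^bsub>H\<^esub> inv\<^bsub>H\<^esub> ((\<rho> \<circ> \<pi>) s)}"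
    if gs: "g \<in> carrier G" "s \<in> S" for g s
  proof -
    have "\<phi> (\<psi> g \<otimes>\<^bsub>G\<^esub> t) \<in> {\<phi> (\<psi> g) \<otimes>\<^bsub>H\<^esub> \<rho> t, \<phi> (\<psi> g) \<otimes>\<^bsub>H\<^esub> inv\<^bsub>H\<^esub> (\<rho> t)}" if "t \<in> S" for t
      using \<rho> gs \<psi> that by (simp add: colour_perm_def)
    from this[OF \<pi>S(1)[OF gs(2)]] this[OF S_closed(2)[OF \<pi>S(1)[OF gs(2)]]]
    \<comment> \<open>The increment of \<open>\<psi>\<close> along \<open>s\<close> may be
      \<open>\<pi> s\<close> or its inverse. Both lie in \<open>S\<close>, and \<open>\<rho>\<close>
      respects inverses, so both lead to the same pair of values.\<close>
    have *: "\<phi> (\<psi> g \<otimes>\<^bsub>G\<^esub> t) \<in> {\<phi> (\<psi> g) \<otimes>\<^bsub>H\<^esub> \<rho> (\<pi> s), \<phi> (\<psi> g) \<otimes>\<^bsub>H\<^esub> inv\<^bsub>H\<^esub> (\<rho> (\<pi> s))}"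
      if "t \<in> {\<pi> s, inv\<^bsub>G\<^esub> (\<pi> s)}" for t
      using that \<pi>S[OF gs(2)] \<rho> by (auto simp: colour_perm_def)
    obtain t where "t \<in> {\<pi> s, inv\<^bsub>G\<^esub> (\<pi> s)}" "\<psi> (g \<otimes>\<^bsub>G\<^esub> s) = \<psi> g \<otimes>\<^bsub>G\<^esub> t"
      using \<pi> gs unfolding colour_perm_def by blast
    then show ?thesis using * by simp
  qed
  moreover have "bij_betw (\<rho> \<circ> \<pi>) S R"
    using \<pi> \<rho> bij_betw_trans unfolding colour_perm_def by blast
  ultimately have "colour_perm G S H R (\<phi> \<circ> \<psi>) (\<rho> \<circ> \<pi>)"
    using \<pi> \<rho> \<pi>S unfolding colour_perm_def by simp
  then show ?thesis using bij_betw_trans[OF b1 b2] chromatic_iso_iff by blast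
qed

text \<open>If the index exceeds 2, adding \<open>2s\<close> on \<open>?K\<close> only is an
  automorphism \<open>\<psi>\<close> that preserves every colour. Then \<open>\<phi>\<close> and
  \<open>\<phi> \<circ> \<psi>\<close> are both affine, but they cannot both be additive at
  \<open>x\<close>, \<open>y\<close> when \<open>x\<close>, \<open>y\<close> and
  \<open>x + y\<close> all lie outside \<open>?K\<close>.\<close>

lemma index_le_2_if_affine:
  assumes chr: "chromatic_iso G S H R \<phi>"
    and aff: "\<forall>\<phi>. chromatic_iso G S H R \<phi> \<longrightarrow> affine_map G H \<phi>"
    and s: "s \<in> S" and ord: "group.ord G s = 4"
  shows "index_le G (generate G (T_set G S (s [^]\<^bsub>G\<^esub> (2::nat)))) 2"
proof (rule ccontr)
  let ?c = "s [^]\<^bsub>G\<^esub> (2::nat)"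
  let ?K = "generate G (T_set G S ?c)"
  assume "\<not> index_le G ?K 2"
  have sub: "subgroup ?K G" by (rule subgroup_generate_T_set[OF G.comm_group_axioms sym_S s])
  obtain x y where xy: "x \<in> carrier G" "y \<in> carrier G" "x \<notin> ?K" "y \<notin> ?K" "x \<otimes>\<^bsub>G\<^esub> y \<notin> ?K"
    using G.not_index_le_2D[OF sub \<open>\<not> index_le G ?K 2\<close>] by blast
  have sc: "s \<in> carrier G" using S_closed s by simp
  have c: "?c \<in> carrier G" using sc by simp
  have cK: "?c \<in> ?K" by (auto intro: generate.incl simp: T_set_def)
  have c1: "?c \<noteq> \<one>\<^bsub>G\<^esub>" using G.pow_eq_id[OF sc, of 2] ord by simp
  have "?c \<otimes>\<^bsub>G\<^esub> ?c = s [^]\<^bsub>G\<^esub> (4::nat)" using sc by (simp add: G.nat_pow_mult)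
  then have c2: "?c \<otimes>\<^bsub>G\<^esub> ?c = \<one>\<^bsub>G\<^esub>" using G.pow_ord_eq_1[OF sc] ord by simp
  \<comment> \<open>Adding an element of \<open>?K\<close> does not change membership in
    \<open>?K\<close>. As \<open>?c\<close> lies in \<open>?K\<close> and \<open>2 ?c = 0\<close>,
    the map \<open>\<psi>\<close> below is an involution.\<close>
  have K: "g \<otimes>\<^bsub>G\<^esub> k \<in> ?K \<longleftrightarrow> g \<in> ?K" if "g \<in> carrier G" "k \<in> ?K" for g k
  proof
    have kc: "k \<in> carrier G" using subgroup.subset[OF sub] that by blast
    assume "g \<otimes>\<^bsub>G\<^esub> k \<in> ?K"
    then have "g \<otimes>\<^bsub>G\<^esub> k \<otimes>\<^bsub>G\<^esub> inv\<^bsub>G\<^esub> k \<in> ?K"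
      using subgroup.m_closed[OF sub] subgroup.m_inv_closed[OF sub] that by blast
    then show "g \<in> ?K" using that kc by (simp add: G.m_assoc)
  qed (use that subgroup.m_closed[OF sub] in blast)
  define \<psi> where "\<psi> g = (if g \<in> ?K then g \<otimes>\<^bsub>G\<^esub> ?c else g)" for g
  have \<psi>c: "\<psi> g \<in> carrier G" if "g \<in> carrier G" for g using that c by (simp add: \<psi>_def)
  have "\<psi> (\<psi> g) = g" if "g \<in> carrier G" for g
    using that c K[OF that cK] by (simp add: \<psi>_def G.m_assoc c2)
  then have bij: "bij_betw \<psi> (carrier G) (carrier G)"
    by (intro bij_betwI[where g = \<psi>]) (auto simp: \<psi>c)
  have "\<psi> (g \<otimes>\<^bsub>G\<^esub> t) \<in> {\<psi> g \<otimes>\<^bsub>G\<^esub> t, \<psi> g \<otimes>\<^bsub>G\<^esub> inv\<^bsub>G\<^esub> t}" if g: "g \<in> carrier G" and t: "t \<in> S" for g t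
  proof (cases "t \<in> ?K")
    case True
    then show ?thesis using K[OF g True] g c S_closed(1)[OF t] by (simp add: \<psi>_def G.m_ac)
  next
    case False
    have tc: "t \<in> carrier G" using S_closed t by simp
    \<comment> \<open>A generator outside \<open>?K\<close> is not in the \<open>T_set\<close>, so
      its double is \<open>?c\<close>. Hence \<open>-t = t + ?c\<close>, and adding
      \<open>?c\<close> at an end of the edge can only exchange the increments \<open>t\<close> and
      \<open>-t\<close>.\<close>
    have "t [^]\<^bsub>G\<^esub> (2::nat) = ?c" using False t generate.incl[of t "T_set G S ?c" G] by (auto simp: T_set_def)
    then have tt: "t \<otimes>\<^bsub>G\<^esub> t = ?c" using tc by (simp add: numeral_2_eq_2)
    have "t \<otimes>\<^bsub>G\<^esub> ?c \<otimes>\<^bsub>G\<^esub> t = \<one>\<^bsub>G\<^esub>" using tc c c2 tt by (metis G.m_assoc G.m_comm)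
    then have i1: "inv\<^bsub>G\<^esub> t = t \<otimes>\<^bsub>G\<^esub> ?c" using tc c G.inv_equality by simp
    have i2: "t \<otimes>\<^bsub>G\<^esub> ?c \<otimes>\<^bsub>G\<^esub> ?c = t" using tc c c2 by (simp add: G.m_assoc)
    show ?thesis using g tc c i2 by (auto simp: \<psi>_def i1 G.m_ac)
  qed
  then have "colour_perm G S G S \<psi> id" by (simp add: colour_perm_def)
  then have "chromatic_iso G S G S \<psi>" using bij cayley_pair.chromatic_iso_iff[OF cayley_pair_self] by blast
  then have "affine_map G H (\<phi> \<circ> \<psi>)" using aff chromatic_iso_comp chr by blast
  moreover have "affine_map G H \<phi>" using aff chr by blast
  moreover have eq: "\<chi> (x \<otimes>\<^bsub>G\<^esub> y) \<otimes>\<^bsub>H\<^esub> \<chi> \<one>\<^bsub>G\<^esub> = \<chi> x \<otimes>\<^bsub>H\<^esub> \<chi> y" if "affine_map G H \<chi>" for \<chi>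
  proof -
    have "y \<in> parallel G H \<chi> x"
      using affine_map_parallel[OF G.comm_group_axioms H.comm_group_axioms that xy(1)] xy by simp
    then have "\<chi> (\<one>\<^bsub>G\<^esub> \<otimes>\<^bsub>G\<^esub> x \<otimes>\<^bsub>G\<^esub> y) \<otimes>\<^bsub>H\<^esub> \<chi> \<one>\<^bsub>G\<^esub> = \<chi> (\<one>\<^bsub>G\<^esub> \<otimes>\<^bsub>G\<^esub> x) \<otimes>\<^bsub>H\<^esub> \<chi> (\<one>\<^bsub>G\<^esub> \<otimes>\<^bsub>G\<^esub> y)"
      unfolding parallel_def by blast
    then show ?thesis using xy by simp
  qed
  ultimately have e1: "\<phi> (x \<otimes>\<^bsub>G\<^esub> y) \<otimes>\<^bsub>H\<^esub> \<phi> \<one>\<^bsub>G\<^esub> = \<phi> x \<otimes>\<^bsub>H\<^esub> \<phi> y"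
    and e2: "(\<phi> \<circ> \<psi>) (x \<otimes>\<^bsub>G\<^esub> y) \<otimes>\<^bsub>H\<^esub> (\<phi> \<circ> \<psi>) \<one>\<^bsub>G\<^esub> = (\<phi> \<circ> \<psi>) x \<otimes>\<^bsub>H\<^esub> (\<phi> \<circ> \<psi>) y"
    by blast+
  \<comment> \<open>The map \<open>\<psi>\<close> fixes \<open>x\<close>, \<open>y\<close> and their
    sum but moves the identity to \<open>?c\<close>. So \<open>e1\<close> and \<open>e2\<close>
    differ only in \<open>\<phi> \<one>\<close> against \<open>\<phi> ?c\<close>, which forces
    \<open>?c = \<one>\<close>.\<close>
  have "\<psi> \<one>\<^bsub>G\<^esub> = ?c" using subgroup.one_closed[OF sub] c by (simp add: \<psi>_def)
  then have "\<phi> (x \<otimes>\<^bsub>G\<^esub> y) \<otimes>\<^bsub>H\<^esub> \<phi> ?c = \<phi> x \<otimes>\<^bsub>H\<^esub> \<phi> y"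
    using e2 xy by (simp add: \<psi>_def)
  moreover have bij\<phi>: "bij_betw \<phi> (carrier G) (carrier H)" using chr chromatic_iso_iff by blast
  then have "\<phi> z \<in> carrier H" if "z \<in> carrier G" for z using that by (auto simp: bij_betw_def)
  ultimately have "\<phi> ?c = \<phi> \<one>\<^bsub>G\<^esub>" using e1 xy c by (metis G.m_closed G.one_closed H.l_cancel)
  then have "?c = \<one>\<^bsub>G\<^esub>" using inj_onD[OF bij_betw_imp_inj_on[OF bij\<phi>]] c by simp
  then show False using c1 by simp
qed

lemma affine_iff_index_le_2:
  assumes "connected_graph (Cay G S)" "chromatic_iso G S H R \<phi>"
  shows "(\<forall>\<phi>. chromatic_iso G S H R \<phi> \<longrightarrow> affine_map G H \<phi>) \<longleftrightarrow>
    (\<forall>s \<in> S. group.ord G s = 4 \<longrightarrow> index_le G (generate G (T_set G S (s [^]\<^bsub>G\<^esub> (2::nat)))) 2)"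
  using affine_if_index_le_2[OF assms(1)] index_le_2_if_affine[OF assms(2)] by blast

section \<open>Exchanging the two groups\<close>

lemma affine_if_inv_affine:
  assumes bij: "bij_betw \<phi> (carrier G) (carrier H)" and aff: "affine_map H G (inv_into (carrier G) \<phi>)"
  shows "affine_map G H \<phi>"
proof -
  obtain \<tau> h where \<tau>: "\<tau> \<in> iso H G" "h \<in> carrier G"
    "\<And>y. y \<in> carrier H \<Longrightarrow> inv_into (carrier G) \<phi> y = \<tau> y \<otimes>\<^bsub>G\<^esub> h"
    using aff by (auto simp: affine_map_def)
  \<comment> \<open>Solving \<open>x = \<tau> y + h\<close> for \<open>y\<close> gives
    \<open>y = \<sigma> (x - h)\<close>, so the linear part of \<open>\<phi>\<close> is the inverse
    of \<open>\<tau>\<close> and its constant is \<open>\<sigma> (-h)\<close>.\<close>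
  let ?\<sigma> = "inv_into (carrier H) \<tau>"
  have \<sigma>: "?\<sigma> \<in> iso G H" by (rule H.iso_set_sym[OF \<tau>(1)])
  have \<tau>b: "bij_betw \<tau> (carrier H) (carrier G)" using \<tau>(1) by (simp add: iso_def)
  have \<sigma>h: "?\<sigma> \<in> hom G H" using \<sigma> by (simp add: iso_def)
  have "\<phi> x = ?\<sigma> x \<otimes>\<^bsub>H\<^esub> ?\<sigma> (inv\<^bsub>G\<^esub> h)" if x: "x \<in> carrier G" for x
  proof -
    have \<phi>x: "\<phi> x \<in> carrier H" using bij x by (auto simp: bij_betw_def)
    have "\<tau> (\<phi> x) \<otimes>\<^bsub>G\<^esub> h = x" using \<tau>(3)[OF \<phi>x] bij x by (simp add: bij_betw_def)
    moreover have \<tau>x: "\<tau> (\<phi> x) \<in> carrier G" using \<tau>b \<phi>x by (auto simp: bij_betw_def)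
    ultimately have "x \<otimes>\<^bsub>G\<^esub> inv\<^bsub>G\<^esub> h = \<tau> (\<phi> x)"
      using \<tau>(2) by (metis G.m_assoc G.inv_closed G.r_inv G.r_one)
    then have "\<phi> x = ?\<sigma> (x \<otimes>\<^bsub>G\<^esub> inv\<^bsub>G\<^esub> h)" using \<tau>b \<phi>x by (simp add: bij_betw_def)
    then show ?thesis using hom_mult[OF \<sigma>h x] \<tau>(2) by simp
  qed
  moreover have "?\<sigma> (inv\<^bsub>G\<^esub> h) \<in> carrier H" using hom_in_carrier[OF \<sigma>h] \<tau>(2) by simp
  ultimately show ?thesis
    unfolding affine_map_def using bij \<sigma>
    by (intro conjI bexI[of _ "?\<sigma> (inv\<^bsub>G\<^esub> h)"] bexI[of _ ?\<sigma>] ballI)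
qed

lemma all_affine_flip:
  assumes "\<forall>\<theta>. chromatic_iso H R G S \<theta> \<longrightarrow> affine_map H G \<theta>" "chromatic_iso G S H R \<phi>"
  shows "affine_map G H \<phi>"
  using assms chromatic_iso_inv affine_if_inv_affine chromatic_iso_iff by blast

end

theorem corollary1p8:
  fixes G\<^sub>1 :: "('a, 'm) monoid_scheme" and G\<^sub>2 :: "('b, 'n) monoid_scheme"
    and S\<^sub>1 :: "'a set" and S\<^sub>2 :: "'b set"
  assumes "comm_group G\<^sub>1" and "comm_group G\<^sub>2"
    and "symmetric_subset G\<^sub>1 S\<^sub>1" and "symmetric_subset G\<^sub>2 S\<^sub>2"
    and "connected_graph (Cay G\<^sub>1 S\<^sub>1)" and "connected_graph (Cay G\<^sub>2 S\<^sub>2)"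
    and "\<exists>\<phi>. chromatic_iso G\<^sub>1 S\<^sub>1 G\<^sub>2 S\<^sub>2 \<phi>"
  shows "((\<forall>\<phi>. chromatic_iso G\<^sub>1 S\<^sub>1 G\<^sub>2 S\<^sub>2 \<phi> \<longrightarrow> affine_map G\<^sub>1 G\<^sub>2 \<phi>) \<longleftrightarrow>
          (\<forall>s \<in> S\<^sub>1. group.ord G\<^sub>1 s = 4 \<longrightarrow>
             index_le G\<^sub>1 (generate G\<^sub>1 (T_set G\<^sub>1 S\<^sub>1 (s [^]\<^bsub>G\<^sub>1\<^esub> (2::nat)))) 2)) \<and>
         ((\<forall>s \<in> S\<^sub>1. group.ord G\<^sub>1 s = 4 \<longrightarrow>
             index_le G\<^sub>1 (generate G\<^sub>1 (T_set G\<^sub>1 S\<^sub>1 (s [^]\<^bsub>G\<^sub>1\<^esub> (2::nat)))) 2) \<longleftrightarrow>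
          (\<forall>t \<in> S\<^sub>2. group.ord G\<^sub>2 t = 4 \<longrightarrow>
             index_le G\<^sub>2 (generate G\<^sub>2 (T_set G\<^sub>2 S\<^sub>2 (t [^]\<^bsub>G\<^sub>2\<^esub> (2::nat)))) 2))"
proof -
  interpret cayley_pair G\<^sub>1 G\<^sub>2 S\<^sub>1 S\<^sub>2
    using assms(1-4) by (simp add: cayley_pair_def cayley_pair_axioms_def)
  obtain \<phi> where \<phi>: "chromatic_iso G\<^sub>1 S\<^sub>1 G\<^sub>2 S\<^sub>2 \<phi>" using assms(7) by blast
  \<comment> \<open>Inversion is a correspondence between the chromatic isomorphisms in the two
    directions that respects affinity. Each side of this equivalence is then turned into the index
    condition in its own source group.\<close>
  have "(\<forall>\<phi>. chromatic_iso G\<^sub>1 S\<^sub>1 G\<^sub>2 S\<^sub>2 \<phi> \<longrightarrow> affine_map G\<^sub>1 G\<^sub>2 \<phi>) \<longleftrightarrow>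
      (\<forall>\<theta>. chromatic_iso G\<^sub>2 S\<^sub>2 G\<^sub>1 S\<^sub>1 \<theta> \<longrightarrow> affine_map G\<^sub>2 G\<^sub>1 \<theta>)"
    using all_affine_flip cayley_pair.all_affine_flip[OF flip] by blast
  then show ?thesis
    using affine_iff_index_le_2[OF assms(5) \<phi>]
      cayley_pair.affine_iff_index_le_2[OF flip assms(6) chromatic_iso_inv[OF \<phi>]] by blast
qed

end
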